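(* Let $f:(0,1)\to(0,1)$. If there is a pushdown automaton that simulates $f$ (for all $p\in(0,1)$), then $f$ is algebraic over $\mathbb Q$: there exists a nonzero polynomial $P\in\mathbb Q[X,Y]$ such that $P(f(p),p)=0$ for all $p\in(0,1)$.
   Context: For $w\in\{0,1\}^*$ let $n_i(w)$ be the number of occurrences of $i$ in $w$; for $p\in(0,1)$ put $\mathbf P_p[w]=p^{n_1(w)}(1-p)^{n_0(w)}$ and $\mathbf P_p[L]=\sum_{w\in L}\mathbf P_p[w]$. A simulation of $f:\mathcal D\to[0,1]$ ($\mathcal D\subseteq(0,1)$) is a pair of disjoint languages $L_0,L_1\subseteq\{0,1\}^*$ with $L_0\cup L_1$ prefix-free (no string is a proper prefix of another) such that $\mathbf P_p[L_0\cup L_1]=1$ and $\mathbf P_p[L_1]=f(p)$ for all $p\in\mathcal D$. A (deterministic) pushdown automaton over input alphabet $\{0,1\}$ consists of a finite state set $S$ with start state $s_0$, a finite stack alphabet $\Lambda$, an initial nonempty stack word $\tau\in\Lambda^*$ (leftmost symbol is the top), a transition map assigning to each $(s,x,b)\in S\times\{0,1\}\times\Lambda$ a new state $\sigma(s,x,b)\in S$ and a word $\rho(s,x,b)\in\Lambda^*$, and two disjoint sets $S_0,S_1\subseteq S$. At each step the automaton reads one input bit $x$; if it is in state $s$ with stack $bu$ ($b$ on top), it moves to state $\sigma(s,x,b)$ with stack $\rho(s,x,b)u$. It stops as soon as the stack is empty, and outputs $i$ if it then is in a state of $S_i$. Let $L_i$ be the set of input strings $w$ such that the stack becomes empty for the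 first time exactly after reading the last symbol of $w$ and the state at that moment lies in $S_i$. The pushdown automaton simulates $f$ if $(L_0,L_1)$ is a simulation of $f$. *)

theory Defs
  imports "HOL-Analysis.Analysis" "HOL-Computational_Algebra.Polynomial"
begin

definition n1 :: "bool list \<Rightarrow> nat" where
  "n1 w = length (filter (\<lambda>x. x) w)"

definition n0 :: "bool list \<Rightarrow> nat" where
  "n0 w = length (filter (\<lambda>x. \<not> x) w)"

definition Pw :: "real \<Rightarrow> bool list \<Rightarrow> real" where
  "Pw p w = p ^ n1 w * (1 - p) ^ n0 w"

definition prefix_free :: "bool list set \<Rightarrow> bool" where
  "prefix_free L \<longleftrightarrow> (\<forall>u\<in>L. \<forall>v\<in>L. \<not> (\<exists>z. z \<noteq> [] \<and> v = u @ z))"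

definition is_simulation ::
  "real set \<Rightarrow> (real \<Rightarrow> real) \<Rightarrow> bool list set \<Rightarrow> bool list set \<Rightarrow> bool" where
  "is_simulation D f L0 L1 \<longleftrightarrow>
     L0 \<inter> L1 = {} \<and> prefix_free (L0 \<union> L1) \<and>
     (\<forall>p\<in>D. (Pw p has_sum 1) (L0 \<union> L1) \<and> (Pw p has_sum f p) L1)"

fun pda_step ::
  "('s \<Rightarrow> bool \<Rightarrow> 'g \<Rightarrow> 's) \<Rightarrow> ('s \<Rightarrow> bool \<Rightarrow> 'g \<Rightarrow> 'g list) \<Rightarrow>
   ('s \<times> 'g list) \<Rightarrow> bool \<Rightarrow> ('s \<times> 'g list)" where
  "pda_step \<sigma> \<rho> (s, []) x = (s, [])"
| "pda_step \<sigma> \<rho> (s, b # u) x = (\<sigma> s x b, \<rho> s x b @ u)"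

definition pda_run ::
  "('s \<Rightarrow> bool \<Rightarrow> 'g \<Rightarrow> 's) \<Rightarrow> ('s \<Rightarrow> bool \<Rightarrow> 'g \<Rightarrow> 'g list) \<Rightarrow>
   ('s \<times> 'g list) \<Rightarrow> bool list \<Rightarrow> ('s \<times> 'g list)" where
  "pda_run \<sigma> \<rho> c w = foldl (pda_step \<sigma> \<rho>) c w"

definition pda_lang ::
  "'s \<Rightarrow> 'g list \<Rightarrow> ('s \<Rightarrow> bool \<Rightarrow> 'g \<Rightarrow> 's) \<Rightarrow> ('s \<Rightarrow> bool \<Rightarrow> 'g \<Rightarrow> 'g list) \<Rightarrow>
   's set \<Rightarrow> bool list set" where
  "pda_lang s0 tau \<sigma> \<rho> Si =
     {w. (\<forall>k<length w. snd (pda_run \<sigma> \<rho> (s0, tau) (take k w)) \<noteq> []) \<and>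
         snd (pda_run \<sigma> \<rho> (s0, tau) w) = [] \<and>
         fst (pda_run \<sigma> \<rho> (s0, tau) w) \<in> Si}"

definition pda_simulates ::
  "'s::finite \<Rightarrow> 'g::finite list \<Rightarrow> ('s \<Rightarrow> bool \<Rightarrow> 'g \<Rightarrow> 's) \<Rightarrow>
   ('s \<Rightarrow> bool \<Rightarrow> 'g \<Rightarrow> 'g list) \<Rightarrow> 's set \<Rightarrow> 's set \<Rightarrow>
   real set \<Rightarrow> (real \<Rightarrow> real) \<Rightarrow> bool" where
  "pda_simulates s0 tau \<sigma> \<rho> S0 S1 D f \<longleftrightarrow>
     tau \<noteq> [] \<and> S0 \<inter> S1 = {} \<and>
     is_simulation D f (pda_lang s0 tau \<sigma> \<rho> S0) (pda_lang s0 tau \<sigma> \<rho> S1)"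

text \<open>Q[X,Y] is represented as (Q[Y])[X], i.e. rat poly poly: the outer
  variable X, the coefficients are polynomials in Y. eval2 P x y = P(x,y).\<close>
definition eval2 :: "rat poly poly \<Rightarrow> real \<Rightarrow> real \<Rightarrow> real" where
  "eval2 P x y = poly (map_poly (\<lambda>q. poly (map_poly of_rat q) y) P) x"

end

theory Submission
  imports Defs
begin

text \<open>Let \<open>F(s, b, s')\<close> be the probability that the automaton, started in state \<open>s\<close> with stack \<open>b\<close>,
  empties its stack in state \<open>s'\<close>. These finitely many functions of \<open>p\<close> form the least nonnegative
  solution of a polynomial system \<open>X\<^sub>i = \<Phi>\<^sub>i(p, X)\<close>, and \<open>f(p)\<close> is a polynomial in them. The system
  may have infinitely many solutions, so it is perturbed to \<open>X\<^sub>i + t X\<^sub>i\<^sup>D = \<Phi>\<^sub>i(p, X)\<close> with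
  \<open>D\<close> larger than the degrees of the \<open>\<Phi>\<^sub>i\<close>. On its solution set every polynomial in \<open>X\<close> is, up to a power
  of \<open>t\<close>, a combination over \<open>\<rat>[t, p]\<close> of the monomials with all exponents below \<open>D\<close>. Having only
  finitely many of these, any polynomial in \<open>X\<close> satisfies a nontrivial algebraic equation over
  \<open>\<rat>[t, p]\<close>, which survives setting \<open>t = 0\<close> after removal of a common power of \<open>t\<close>. For \<open>t > 0\<close> the
  left-hand side only grows, so the perturbed system has a solution below \<open>F\<close>, and it converges to \<open>F\<close>
  as \<open>t\<close> tends to 0.\<close>

section \<open>Evaluation of polynomials\<close>

lemma poly_map_poly_pCons:
  assumes "h 0 = 0"
  shows "poly (map_poly h (pCons a P)) x = h a + x * poly (map_poly h P) x"
  using assms by (simp add: map_poly_pCons)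

lemma poly_map_poly_hom_add:
  fixes h :: "'a::comm_ring_1 \<Rightarrow> 'b::comm_ring_1"
  assumes "h 0 = 0" "\<And>a b. h (a + b) = h a + h b"
  shows "poly (map_poly h (P + Q)) x = poly (map_poly h P) x + poly (map_poly h Q) x"
  by (induction P Q rule: poly_induct2)
    (simp_all add: poly_map_poly_pCons assms algebra_simps)

lemma poly_map_poly_hom_mult:
  fixes h :: "'a::comm_ring_1 \<Rightarrow> 'b::comm_ring_1"
  assumes "h 0 = 0" "\<And>a b. h (a + b) = h a + h b" "\<And>a b. h (a * b) = h a * h b"
  shows "poly (map_poly h (P * Q)) x = poly (map_poly h P) x * poly (map_poly h Q) x"
  by (induction P)
    (simp_all add: poly_map_poly_pCons poly_map_poly_hom_add map_poly_smult
      assms algebra_simps)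

definition eval1 :: "rat poly \<Rightarrow> real \<Rightarrow> real" where
  "eval1 q y = poly (map_poly of_rat q) y"

lemma eval1_0 [simp]: "eval1 0 y = 0"
  and eval1_1 [simp]: "eval1 1 y = 1"
  by (simp_all add: eval1_def map_poly_pCons)

lemma eval1_add: "eval1 (a + b) y = eval1 a y + eval1 b y"
  unfolding eval1_def by (rule poly_map_poly_hom_add) (simp_all add: of_rat_add)

lemma eval1_mult: "eval1 (a * b) y = eval1 a y * eval1 b y"
  unfolding eval1_def by (rule poly_map_poly_hom_mult) (simp_all add: of_rat_add of_rat_mult)

lemma eval2_eval1: "eval2 P x y = poly (map_poly (\<lambda>q. eval1 q y) P) x"
  by (simp add: eval2_def eval1_def)

lemma eval2_0 [simp]: "eval2 0 x y = 0"
  by (simp add: eval2_eval1)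

lemma eval2_pCons: "eval2 (pCons a P) x y = eval1 a y + x * eval2 P x y"
  unfolding eval2_eval1 by (rule poly_map_poly_pCons) simp

lemma eval2_add: "eval2 (P + Q) x y = eval2 P x y + eval2 Q x y"
  unfolding eval2_eval1 by (rule poly_map_poly_hom_add) (simp_all add: eval1_add)

lemma eval2_mult: "eval2 (P * Q) x y = eval2 P x y * eval2 Q x y"
  unfolding eval2_eval1 by (rule poly_map_poly_hom_mult) (simp_all add: eval1_add eval1_mult)

lemma eval2_1 [simp]: "eval2 1 x y = 1"
  by (subst one_pCons) (simp add: eval2_pCons)

lemma eval2_sum: "eval2 (\<Sum>i\<in>I. P i) x y = (\<Sum>i\<in>I. eval2 (P i) x y)"
  by (induction I rule: infinite_finite_induct) (simp_all add: eval2_add)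

lemma eval2_monom: "eval2 (monom a n) x y = eval1 a y * x ^ n"
  by (induction n) (simp_all add: monom_0 monom_Suc eval2_pCons)

text \<open>In coefficients from Q[t, p] the outer variable is t and the inner one p, so setting t =
  0 keeps just the constant outer coefficient, a polynomial in p.\<close>

lemma eval2_at_0: "eval2 P 0 y = eval1 (coeff P 0) y"
  by (cases P) (simp add: eval2_pCons)

lemma tendsto_eval2:
  assumes "(g \<longlongrightarrow> x) F"
  shows "((\<lambda>n. eval2 P (g n) y) \<longlongrightarrow> eval2 P x y) F"
  unfolding eval2_def using assms by (rule tendsto_poly)

section \<open>Algebraic relations on the perturbed system\<close>

text \<open>Fraction-free Gaussian elimination: a pivot row \<open>i0\<close> with a nonzero entry
  in coordinate \<open>j\<close> clears that coordinate from all other rows by cross-multiplication,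
  and one row and one coordinate fewer remain.\<close>

lemma idom_linear_dependence:
  fixes v :: "'i \<Rightarrow> 'j \<Rightarrow> 'a::idom"
  assumes "finite J" "finite I" "card J < card I"
  shows "\<exists>c. (\<exists>i\<in>I. c i \<noteq> 0) \<and> (\<forall>j\<in>J. (\<Sum>i\<in>I. c i * v i j) = 0)"
  using assms
proof (induction J arbitrary: I v rule: finite_induct)
  case empty
  then have "I \<noteq> {}" by auto
  then show ?case by (intro exI[of _ "\<lambda>_. 1"]) auto
next
  case (insert j J)
  show ?case
  proof (cases "\<forall>i\<in>I. v i j = 0")
    case True
    have "card J < card I" using insert by simp
    from insert.IH[OF \<open>finite I\<close> this, of v] obtain c
      where c: "\<exists>i\<in>I. c i \<noteq> 0" "\<forall>l\<in>J. (\<Sum>i\<in>I. c i * v i l) = 0" by blast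
    have "(\<Sum>i\<in>I. c i * v i j) = 0" using True by simp
    with c show ?thesis by blast
  next
    case False
    then obtain i0 where i0: "i0 \<in> I" "v i0 j \<noteq> 0" by blast
    define I' where "I' = I - {i0}"
    have I': "finite I'" "i0 \<notin> I'" "I = insert i0 I'"
      using i0 insert.prems by (auto simp: I'_def)
    have "card J < card I'" using insert.prems insert.hyps I' by simp
    from insert.IH[OF I'(1) this, of "\<lambda>i l. v i0 j * v i l - v i j * v i0 l"]
    obtain c where c: "\<exists>i\<in>I'. c i \<noteq> 0"
      "\<And>l. l \<in> J \<Longrightarrow> (\<Sum>i\<in>I'. c i * (v i0 j * v i l - v i j * v i0 l)) = 0" by blast
    \<comment> \<open>Undoing the elimination: the other rows are scaled by the pivot, nonzero in a
      domain, and \<open>i0\<close> absorbs the subtracted multiples. Coordinate \<open>j\<close>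
      then cancels identically.\<close>
    define d where "d i = (if i = i0 then - (\<Sum>i\<in>I'. c i * v i j) else c i * v i0 j)" for i
    have eq: "(\<Sum>i\<in>I. d i * v i l) = (\<Sum>i\<in>I'. c i * (v i0 j * v i l - v i j * v i0 l))" for l
    proof -
      have "(\<Sum>i\<in>I'. d i * v i l) = (\<Sum>i\<in>I'. c i * v i0 j * v i l)"
        using I'(2) by (intro sum.cong) (auto simp: d_def)
      then show ?thesis using I'
        by (simp add: d_def sum_distrib_left sum_distrib_right sum_subtractf right_diff_distrib mult_ac)
    qed
    have "\<exists>i\<in>I. d i \<noteq> 0"
    proof -
      obtain i where "i \<in> I'" "c i \<noteq> 0" using c(1) by blast
      then show ?thesis using I' i0 by (intro bexI[of _ i]) (auto simp: d_def)
    qed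
    moreover have "(\<Sum>i\<in>I. d i * v i l) = 0" if "l \<in> insert j J" for l
      using that c(2) unfolding eq by (auto simp: mult.commute)
    ultimately show ?thesis by blast
  qed
qed

text \<open>Dividing out the largest common power of the outer variable makes the specialisation
  at 0 nontrivial.\<close>
lemma common_power_of_var:
  fixes c :: "nat \<Rightarrow> 'a::comm_ring_1 poly"
  assumes "\<exists>k\<in>K. c k \<noteq> 0"
  obtains e c' where "\<And>k. k \<in> K \<Longrightarrow> c k = monom 1 e * c' k" "\<exists>k\<in>K. coeff (c' k) 0 \<noteq> 0"
proof -
  define Q where "Q j \<longleftrightarrow> (\<exists>k\<in>K. coeff (c k) j \<noteq> 0)" for j
  have "\<exists>j. Q j" using assms unfolding Q_def by (metis leading_coeff_neq_0)
  then have Q: "Q (LEAST j. Q j)" by (rule LeastI_ex)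
  \<comment> \<open>\<open>e\<close> is the lowest degree occurring in any \<open>c k\<close>, so
    shifting by \<open>e\<close> loses nothing and leaves some nonzero constant coefficient.\<close>
  define e where "e = (LEAST j. Q j)"
  have low: "coeff (c k) j = 0" if "j < e" "k \<in> K" for j k
    using not_less_Least[OF that(1)[unfolded e_def]] that(2) by (auto simp: Q_def)
  show thesis
  proof
    show "c k = monom 1 e * poly_shift e (c k)" if "k \<in> K" for k
      using low that by (intro poly_eqI) (auto simp: coeff_monom_mult coeff_poly_shift)
    show "\<exists>k\<in>K. coeff (poly_shift e (c k)) 0 \<noteq> 0"
      using Q by (simp add: Q_def e_def coeff_poly_shift)
  qed
qed

section \<open>Monomials and polynomial functions in the unknowns\<close>

definition mon :: "('i::finite \<Rightarrow> nat) \<Rightarrow> ('i \<Rightarrow> real) \<Rightarrow> real" where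
  "mon a X = (\<Prod>i\<in>UNIV. X i ^ a i)"

lemma mon_add: "mon (\<lambda>i. a i + b i) X = mon a X * mon b X"
  by (simp add: mon_def power_add prod.distrib)

lemma mon_0 [simp]: "mon (\<lambda>_. 0) X = 1"
  by (simp add: mon_def)

lemma mon_single: "mon (\<lambda>j. if j = i then n else 0) X = X i ^ n"
proof -
  have "mon (\<lambda>j. if j = i then n else 0) X = (\<Prod>j\<in>UNIV. if j = i then X i ^ n else 1)"
    unfolding mon_def by (intro prod.cong) auto
  then show ?thesis by simp
qed

text \<open>Polynomials in the unknowns \<open>X\<close> of degree at most \<open>d\<close> with coefficients in \<open>\<rat>[t, p]\<close>,
  represented by the functions they define.\<close>
inductive polyfun :: "nat \<Rightarrow> (real \<Rightarrow> real \<Rightarrow> ('i::finite \<Rightarrow> real) \<Rightarrow> real) \<Rightarrow> bool" where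
  mon: "(\<Sum>i\<in>UNIV. a i) \<le> d \<Longrightarrow> polyfun d (\<lambda>t p X. eval2 c t p * mon a X)"
| add: "polyfun d g \<Longrightarrow> polyfun d h \<Longrightarrow> polyfun d (\<lambda>t p X. g t p X + h t p X)"

lemma polyfun_coeff: "polyfun d (\<lambda>t p X. eval2 c t p)"
  using polyfun.mon[of "\<lambda>_. 0" d c] by simp

lemma polyfun_const: "polyfun d (\<lambda>t p X. 0)" "polyfun d (\<lambda>t p X. 1)"
  using polyfun_coeff[of d 0] polyfun_coeff[of d 1] by simp_all

lemma polyfun_param: "polyfun d (\<lambda>t p X. p)" "polyfun d (\<lambda>t p X. 1 - p)"
proof -
  have "eval2 [:[:0, 1:]:] t p = p" "eval2 [:[:1, -1:]:] t p = 1 - p" for t p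
    by (simp_all add: eval2_pCons eval1_def map_poly_pCons)
  then show "polyfun d (\<lambda>t p X. p)" "polyfun d (\<lambda>t p X. 1 - p)"
    using polyfun_coeff[of d "[:[:0, 1:]:]"] polyfun_coeff[of d "[:[:1, -1:]:]"] by simp_all
qed

lemma polyfun_var: "polyfun (Suc d) (\<lambda>t p X. X i)"
  using polyfun.mon[of "\<lambda>j. if j = i then 1 else 0" "Suc d" 1] by (simp add: mon_single)

lemma polyfun_mono: "polyfun d g \<Longrightarrow> d \<le> e \<Longrightarrow> polyfun e g"
  by (induction rule: polyfun.induct) (auto intro: polyfun.intros)

lemma polyfun_mult:
  assumes "polyfun d g" "polyfun e h"
  shows "polyfun (d + e) (\<lambda>t p X. g t p X * h t p X)"
  using assms(1)
proof induction
  case (mon a d c)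
  note a = mon
  show ?case using assms(2)
  proof induction
    case (mon b e c')
    have "polyfun (d + e) (\<lambda>t p X. eval2 (c * c') t p * mon (\<lambda>i. a i + b i) X)"
      using a mon by (intro polyfun.mon) (simp add: sum.distrib)
    then show ?case by (simp add: eval2_mult mon_add mult_ac)
  next
    case (add e g h)
    then show ?case by (simp add: distrib_left polyfun.add)
  qed
next
  case (add d g h)
  then show ?case by (simp add: distrib_right polyfun.add)
qed

lemma polyfun_sum:
  assumes "\<And>r. r \<in> R \<Longrightarrow> polyfun d (g r)"
  shows "polyfun d (\<lambda>t p X. \<Sum>r\<in>R. g r t p X)"
  using assms
  by (induction R rule: infinite_finite_induct) (auto intro: polyfun_const polyfun.add)

lemma polyfun_power:
  assumes "polyfun d g"
  shows "polyfun (k * d) (\<lambda>t p X. g t p X ^ k)"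
  using assms by (induction k) (auto intro: polyfun_const polyfun_mult)

lemma polyfun_diff:
  assumes "polyfun d g" "polyfun d h"
  shows "polyfun d (\<lambda>t p X. g t p X - h t p X)"
proof -
  have "eval2 [:[:-1:]:] t p = -1" for t p
    by (simp add: eval2_pCons eval1_def map_poly_pCons)
  then have "polyfun d (\<lambda>t p X. - h t p X)"
    using polyfun_mult[OF polyfun_coeff[of 0 "[:[:-1:]:]"] assms(2)] by simp
  from polyfun.add[OF assms(1) this] show ?thesis by simp
qed

text \<open>The exponent \<open>e\<close> and the coefficients \<open>c\<close> are chosen once for
  the whole of \<open>V\<close>. A relation derived from them is therefore uniform in t and p, as a
  single polynomial for all p requires.\<close>

definition reducible ::
  "nat \<Rightarrow> (real \<times> real \<times> ('i::finite \<Rightarrow> real)) set \<Rightarrow>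
   (real \<Rightarrow> real \<Rightarrow> ('i \<Rightarrow> real) \<Rightarrow> real) \<Rightarrow> bool" where
  "reducible D V g \<longleftrightarrow> (\<exists>e c. \<forall>(t, p, X)\<in>V.
     t ^ e * g t p X = (\<Sum>b | \<forall>i. b i < D. eval2 (c b) t p * mon b X))"

lemma reducibleI:
  assumes "\<And>t p X. (t, p, X) \<in> V \<Longrightarrow>
    t ^ e * g t p X = (\<Sum>b | \<forall>i. b i < D. eval2 (c b) t p * mon b X)"
  shows "reducible D V g"
  unfolding reducible_def using assms by (intro exI[of _ e] exI[of _ c]) auto

lemma reducible_add:
  assumes "reducible D V g" "reducible D V h"
  shows "reducible D V (\<lambda>t p X. g t p X + h t p X)"
proof -
  obtain e c e' c' where
    *: "\<And>t p X. (t, p, X) \<in> V \<Longrightarrow> t ^ e * g t p X = (\<Sum>b | \<forall>i. b i < D. eval2 (c b) t p * mon b X)"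
       "\<And>t p X. (t, p, X) \<in> V \<Longrightarrow> t ^ e' * h t p X = (\<Sum>b | \<forall>i. b i < D. eval2 (c' b) t p * mon b X)"
    using assms unfolding reducible_def by fastforce
  have "t ^ (e + e') * (g t p X + h t p X) = (\<Sum>b | \<forall>i. b i < D.
      eval2 (monom 1 e' * c b + monom 1 e * c' b) t p * mon b X)" if "(t, p, X) \<in> V" for t p X
  proof -
    have "t ^ (e + e') * (g t p X + h t p X) = t ^ e' * (t ^ e * g t p X) + t ^ e * (t ^ e' * h t p X)"
      by (simp add: power_add algebra_simps)
    then show ?thesis using *[OF that]
      by (simp add: sum_distrib_left sum.distrib eval2_add eval2_mult eval2_monom algebra_simps)
  qed
  then show ?thesis by (rule reducibleI)
qed

lemma reducible_scale:
  assumes "reducible D V g"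
  shows "reducible D V (\<lambda>t p X. eval2 a t p * g t p X)"
proof -
  obtain e c where
    *: "\<And>t p X. (t, p, X) \<in> V \<Longrightarrow> t ^ e * g t p X = (\<Sum>b | \<forall>i. b i < D. eval2 (c b) t p * mon b X)"
    using assms unfolding reducible_def by fastforce
  have "t ^ e * (eval2 a t p * g t p X) = (\<Sum>b | \<forall>i. b i < D. eval2 (a * c b) t p * mon b X)"
    if "(t, p, X) \<in> V" for t p X
  proof -
    have "t ^ e * (eval2 a t p * g t p X) = eval2 a t p * (t ^ e * g t p X)"
      by (simp add: algebra_simps)
    then show ?thesis using *[OF that]
      by (simp add: sum_distrib_left eval2_mult algebra_simps)
  qed
  then show ?thesis by (rule reducibleI)
qed

text \<open>A function of degree at most \<open>d\<close> is built from monomials of degree at most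
  \<open>d\<close> only, and reducibility respects sums and scaling by Q[t, p]. Keeping the bound on
  \<open>b\<close> serves an induction on the degree.\<close>

lemma reducible_polyfun:
  assumes "polyfun d g" "\<And>b. (\<Sum>i\<in>UNIV. b i) \<le> d \<Longrightarrow> reducible D V (\<lambda>t p X. mon b X)"
  shows "reducible D V g"
  using assms by induction (auto intro: reducible_add reducible_scale)

lemma finite_bounded_exponents: "finite {b :: 'i::finite \<Rightarrow> nat. \<forall>i. b i < D}"
proof -
  have "{b :: 'i \<Rightarrow> nat. \<forall>i. b i < D} = (\<Pi>\<^sub>E i\<in>UNIV. {..<D})"
    by (auto simp: PiE_def extensional_def)
  then show ?thesis by (simp add: finite_PiE)
qed

text \<open>On the perturbed system, \<open>t X\<^sub>i\<^sup>D\<close> can be traded for terms of smaller degree.\<close>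
lemma reducible_mon:
  fixes \<Phi> :: "'i::finite \<Rightarrow> real \<Rightarrow> real \<Rightarrow> ('i \<Rightarrow> real) \<Rightarrow> real"
  assumes \<Phi>: "\<And>i. polyfun d (\<Phi> i)" and d: "0 < d" "d < D"
    and V: "\<And>t p X i. (t, p, X) \<in> V \<Longrightarrow> X i + t * X i ^ D = \<Phi> i t p X"
  shows "reducible D V (\<lambda>t p X. mon a X)"
proof (induction "\<Sum>i\<in>UNIV. a i" arbitrary: a rule: less_induct)
  case less
  show ?case
  proof (cases "\<forall>i. a i < D")
    case True
    have "t ^ 0 * mon a X = (\<Sum>b | \<forall>i. b i < D. eval2 (if b = a then 1 else 0) t p * mon b X)"
      for t p X
    proof -
      have "(\<Sum>b | \<forall>i. b i < D. eval2 (if b = a then 1 else 0) t p * mon b X)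
        = (\<Sum>b | \<forall>i. b i < D. if b = a then mon a X else 0)"
        by (intro sum.cong) auto
      then show ?thesis using True by (simp add: finite_bounded_exponents)
    qed
    then show ?thesis by (rule reducibleI)
  next
    case False
    then obtain i where i: "D \<le> a i" by (auto simp: not_less)
    define a' where "a' j = (if j = i then a i - D else a j)" for j
    have a: "a = (\<lambda>j. a' j + (if j = i then D else 0))"
      using i by (auto simp: a'_def)
    have sum_a: "(\<Sum>j\<in>UNIV. a j) = (\<Sum>j\<in>UNIV. a' j) + D"
      by (subst a) (simp add: sum.distrib)
    \<comment> \<open>On \<open>V\<close>, \<open>g\<close> equals t times \<open>mon a X\<close>,
      since \<open>\<Phi> i t p X - X i = t * X i ^ D\<close>. Its degree is at most that of
      \<open>a'\<close> plus \<open>d\<close>, which \<open>d < D\<close> makes smaller than that of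
      \<open>a\<close>, so the induction hypothesis applies.\<close>
    define g where "g t p X = mon a' X * (\<Phi> i t p X - X i)" for t p X
    have "polyfun ((\<Sum>j\<in>UNIV. a' j) + d) g"
    proof -
      have "polyfun (\<Sum>j\<in>UNIV. a' j) (\<lambda>t p X. mon a' X)"
        using polyfun.mon[of a' "\<Sum>j\<in>UNIV. a' j" 1] by simp
      \<comment> \<open>Subtracting the linear term \<open>X i\<close> stays within degree
        \<open>d\<close> because \<open>d\<close> is positive.\<close>
      moreover have "polyfun d (\<lambda>t p X. X i)"
        using polyfun_var[of "d - 1" i] d by simp
      ultimately show ?thesis
        unfolding g_def by (intro polyfun_mult polyfun_diff \<Phi>)
    qed
    then have "reducible D V g"
    proof (rule reducible_polyfun)
      fix b :: "'i \<Rightarrow> nat" assume "(\<Sum>i\<in>UNIV. b i) \<le> (\<Sum>j\<in>UNIV. a' j) + d"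
      then have "(\<Sum>i\<in>UNIV. b i) < (\<Sum>i\<in>UNIV. a i)" using sum_a d by simp
      then show "reducible D V (\<lambda>t p X. mon b X)" by (rule less.hyps)
    qed
    then obtain e c where
      *: "\<And>t p X. (t, p, X) \<in> V \<Longrightarrow> t ^ e * g t p X = (\<Sum>b | \<forall>i. b i < D. eval2 (c b) t p * mon b X)"
      unfolding reducible_def by fastforce
    have "t ^ Suc e * mon a X = (\<Sum>b | \<forall>i. b i < D. eval2 (c b) t p * mon b X)"
      if "(t, p, X) \<in> V" for t p X
    proof -
      have "mon a X = mon a' X * X i ^ D"
        by (subst a) (simp add: mon_add mon_single)
      moreover have "t * X i ^ D = \<Phi> i t p X - X i"
        using V[OF that, of i] by simp
      ultimately have "t * mon a X = g t p X"
        by (simp only: g_def mult.left_commute[of t "mon a' X"])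
      then have "t ^ Suc e * mon a X = t ^ e * g t p X" by (simp add: mult_ac)
      then show ?thesis using *[OF that] by simp
    qed
    then show ?thesis by (rule reducibleI)
  qed
qed

text \<open>A counting argument: the \<open>N + 1\<close> powers of \<open>g\<close> with exponents
  0 to \<open>N\<close> reduce to combinations of only \<open>N\<close> monomials, so their
  coefficient vectors are linearly dependent over Q[t, p]. Removing the common power of t leaves
  some coefficient nonzero, as a polynomial in p, at t = 0.\<close>

lemma perturbed_algebraic_relation:
  fixes \<Phi> :: "'i::finite \<Rightarrow> real \<Rightarrow> real \<Rightarrow> ('i \<Rightarrow> real) \<Rightarrow> real"
  assumes \<Phi>: "\<And>i. polyfun d (\<Phi> i)" and d: "0 < d" "d < D"
    and V: "\<And>t p X i. (t, p, X) \<in> V \<Longrightarrow> X i + t * X i ^ D = \<Phi> i t p X"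
    and g: "polyfun m g"
  obtains N c where "\<exists>k\<in>{..N}. coeff (c k) 0 \<noteq> 0"
    "\<And>t p X. (t, p, X) \<in> V \<Longrightarrow> t \<noteq> 0 \<Longrightarrow> (\<Sum>k\<le>N. eval2 (c k) t p * g t p X ^ k) = 0"
proof -
  define B where "B = {b :: 'i \<Rightarrow> nat. \<forall>i. b i < D}"
  define N where "N = card B"
  have "reducible D V (\<lambda>t p X. g t p X ^ k)" for k
    using polyfun_power[OF g] reducible_mon[OF \<Phi> d V] by (rule reducible_polyfun)
  then have "\<forall>k. \<exists>e c. \<forall>(t, p, X)\<in>V. t ^ e * g t p X ^ k = (\<Sum>b\<in>B. eval2 (c b) t p * mon b X)"
    unfolding reducible_def B_def by blast
  from choice[OF this] obtain e where
    "\<forall>k. \<exists>c. \<forall>(t, p, X)\<in>V. t ^ e k * g t p X ^ k = (\<Sum>b\<in>B. eval2 (c b) t p * mon b X)"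
    by blast
  from choice[OF this] obtain a where
    "\<forall>k. \<forall>(t, p, X)\<in>V. t ^ e k * g t p X ^ k = (\<Sum>b\<in>B. eval2 (a k b) t p * mon b X)"
    by blast
  then have ea: "t ^ e k * g t p X ^ k = (\<Sum>b\<in>B. eval2 (a k b) t p * mon b X)"
    if "(t, p, X) \<in> V" for k t p X
    using that by fastforce
  have "\<exists>c. (\<exists>k\<in>{..N}. c k \<noteq> 0) \<and> (\<forall>b\<in>B. (\<Sum>k\<in>{..N}. c k * a k b) = 0)"
    using finite_bounded_exponents by (intro idom_linear_dependence) (auto simp: N_def B_def)
  then obtain c where c: "\<exists>k\<in>{..N}. c k \<noteq> 0" "\<And>b. b \<in> B \<Longrightarrow> (\<Sum>k\<le>N. c k * a k b) = 0"
    by blast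
  \<comment> \<open>The dependence concerns the products of \<open>t ^ e k\<close> with the k-th
    power of \<open>g\<close>; moving \<open>t ^ e k\<close> into the coefficients makes it a
    relation between the powers themselves.\<close>
  have "\<exists>k\<in>{..N}. monom 1 (e k) * c k \<noteq> 0" using c(1) by simp
  then obtain l c' where c': "\<And>k. k \<in> {..N} \<Longrightarrow> monom 1 (e k) * c k = monom 1 l * c' k"
    "\<exists>k\<in>{..N}. coeff (c' k) 0 \<noteq> 0"
    by (rule common_power_of_var) (rule that)
  have "(\<Sum>k\<le>N. eval2 (c' k) t p * g t p X ^ k) = 0" if "(t, p, X) \<in> V" "t \<noteq> 0" for t p X
  proof -
    have "t ^ l * (\<Sum>k\<le>N. eval2 (c' k) t p * g t p X ^ k)
        = (\<Sum>k\<le>N. eval2 (monom 1 l * c' k) t p * g t p X ^ k)"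
      by (simp add: sum_distrib_left eval2_mult eval2_monom mult.assoc)
    also have "\<dots> = (\<Sum>k\<le>N. eval2 (c k) t p * (t ^ e k * g t p X ^ k))"
    proof (rule sum.cong)
      fix k assume "k \<in> {..N}"
      then show "eval2 (monom 1 l * c' k) t p * g t p X ^ k = eval2 (c k) t p * (t ^ e k * g t p X ^ k)"
        by (subst c'(1)[symmetric]) (simp_all add: eval2_mult eval2_monom)
    qed simp
    also have "\<dots> = (\<Sum>k\<le>N. \<Sum>b\<in>B. eval2 (c k * a k b) t p * mon b X)"
      by (simp add: ea[OF that(1)] sum_distrib_left eval2_mult mult.assoc)
    also have "\<dots> = (\<Sum>b\<in>B. eval2 (\<Sum>k\<le>N. c k * a k b) t p * mon b X)"
      by (subst sum.swap) (simp add: eval2_sum sum_distrib_right)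
    also have "\<dots> = 0" using c(2) by simp
    finally show ?thesis using that(2) by simp
  qed
  with c'(2) show thesis by (rule that)
qed

section \<open>Convergence of the perturbed solutions\<close>

text \<open>For each \<open>n\<close> the solution is the limit of a monotone iteration from 0. It
  stays below \<open>F\<close> because \<open>\<Phi> F\<close> does and the perturbation only lowers
  values. From below, a fixed number \<open>k\<close> of steps tends to the unperturbed iterate as
  \<open>t n\<close> vanishes; that iterate dominates \<open>T k\<close>, which tends to
  \<open>F\<close>.\<close>

lemma perturbed_fixpoints_converge:
  fixes \<Phi> :: "('i \<Rightarrow> real) \<Rightarrow> 'i \<Rightarrow> real" and T :: "nat \<Rightarrow> 'i \<Rightarrow> real"
  assumes nonneg: "\<And>X i. (\<And>j. 0 \<le> X j) \<Longrightarrow> 0 \<le> \<Phi> X i"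
    and mono: "\<And>X Y i. (\<And>j. 0 \<le> X j) \<Longrightarrow> (\<And>j. X j \<le> Y j) \<Longrightarrow> \<Phi> X i \<le> \<Phi> Y i"
    and cont: "\<And>X L i. (\<And>j. (\<lambda>n. X n j) \<longlonglongrightarrow> L j) \<Longrightarrow> (\<lambda>n. \<Phi> (X n) i) \<longlonglongrightarrow> \<Phi> L i"
    and F: "\<And>i. 0 \<le> F i" "\<And>i. F i \<le> 1" "\<And>i. \<Phi> F i \<le> F i"
    and T: "\<And>i. T 0 i = 0" "\<And>k i. 0 \<le> T k i" "\<And>k i. T (Suc k) i \<le> \<Phi> (T k) i"
      "\<And>i. (\<lambda>k. T k i) \<longlonglongrightarrow> F i"
    and D: "0 < D" and t: "\<And>n. 0 < t n" "t \<longlonglongrightarrow> 0"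
  obtains X where "\<And>n i. X n i + t n * X n i ^ D = \<Phi> (X n) i" "\<And>i. (\<lambda>n. X n i) \<longlonglongrightarrow> F i"
proof -
  have root: "\<exists>u. 0 \<le> u \<and> u + s * u ^ D = v" if "0 \<le> v" "0 < s" for s v :: real
  proof -
    have "\<exists>u. 0 \<le> u \<and> u \<le> v \<and> u + s * u ^ D = v"
      using that D by (intro IVT') (auto intro!: continuous_intros simp: zero_power)
    then show ?thesis by blast
  qed
  \<comment> \<open>\<open>g s\<close> inverts u + s u^D on the nonnegative reals. The perturbed
    equation becomes \<open>X = g t (\<Phi> X)\<close> in each component, with a monotone right-hand
    side.\<close>
  define g where "g s v = (SOME u. 0 \<le> u \<and> u + s * u ^ D = v)" for s v :: real
  have g: "0 \<le> g s v" "g s v + s * g s v ^ D = v" if "0 \<le> v" "0 < s" for s v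
    using someI_ex[OF root[OF that]] unfolding g_def by blast+
  have g_le: "g s v \<le> v" if "0 \<le> v" "0 < s" for s v
  proof -
    have "0 \<le> s * g s v ^ D" using g(1)[OF that] that by simp
    then show ?thesis using g(2)[OF that] by simp
  qed
  have g_mono: "g s v \<le> g s w" if "0 \<le> v" "v \<le> w" "0 < s" for s v w
  proof (rule ccontr)
    assume less: "\<not> g s v \<le> g s w"
    have "0 \<le> w" using that by simp
    have "g s w ^ D \<le> g s v ^ D" using less g(1)[OF \<open>0 \<le> w\<close> that(3)] by (intro power_mono) auto
    then have "s * g s w ^ D \<le> s * g s v ^ D" using that(3) by simp
    then show False using g(2)[OF that(1,3)] g(2)[OF \<open>0 \<le> w\<close> that(3)] that(2) less by linarith
  qed
  define Y where "Y n k = ((\<lambda>Z i. g (t n) (\<Phi> Z i)) ^^ k) (\<lambda>_. 0)" for n k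
  have Y0: "Y n 0 i = 0" and Y_Suc: "Y n (Suc k) i = g (t n) (\<Phi> (Y n k) i)" for n k i
    by (simp_all add: Y_def)
  have Y_nonneg: "0 \<le> Y n k i" for n k i
    by (induction k arbitrary: i) (auto simp: Y0 Y_Suc t intro!: g nonneg)
  have Y_le: "Y n k i \<le> F i" for n k i
  proof (induction k arbitrary: i)
    case (Suc k)
    have "g (t n) (\<Phi> (Y n k) i) \<le> \<Phi> (Y n k) i"
      by (intro g_le nonneg Y_nonneg t)
    also have "\<dots> \<le> \<Phi> F i" by (intro mono Y_nonneg Suc)
    also have "\<dots> \<le> F i" by (rule F)
    finally show ?case by (simp add: Y_Suc)
  qed (simp add: Y0 F)
  have Y_mono: "Y n k i \<le> Y n (Suc k) i" for n k i
  proof (induction k arbitrary: i)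
    case (Suc k)
    have "\<Phi> (Y n k) i \<le> \<Phi> (Y n (Suc k)) i"
      by (rule mono) (rule Y_nonneg, rule Suc)
    then show ?case unfolding Y_Suc[of n k i] Y_Suc[of n "Suc k" i]
      by (intro g_mono nonneg Y_nonneg t)
  qed (simp add: Y0 Y_nonneg)
  have inc: "incseq (\<lambda>k. Y n k i)" for n i
    using Y_mono by (intro incseq_SucI)
  have "\<exists>L. (\<lambda>k. Y n k i) \<longlonglongrightarrow> L" for n i
    using incseq_convergent[OF inc, of n i "F i"] Y_le by metis
  then obtain X where X: "\<And>n i. (\<lambda>k. Y n k i) \<longlonglongrightarrow> X n i" by metis
  have Y_le_X: "Y n k i \<le> X n i" for n k i
    using incseq_le[OF inc X] .
  have X_le: "X n i \<le> F i" for n i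
    using LIMSEQ_le_const2[OF X] Y_le by blast
  have fixpoint: "X n i + t n * X n i ^ D = \<Phi> (X n) i" for n i
  proof (rule LIMSEQ_unique)
    have "Y n (Suc k) i + t n * Y n (Suc k) i ^ D = \<Phi> (Y n k) i" for k
      unfolding Y_Suc by (intro g nonneg Y_nonneg t)
    moreover have "(\<lambda>k. Y n (Suc k) i + t n * Y n (Suc k) i ^ D) \<longlonglongrightarrow> X n i + t n * X n i ^ D"
      using X[of n i] by (intro tendsto_intros LIMSEQ_Suc)
    ultimately show "(\<lambda>k. \<Phi> (Y n k) i) \<longlonglongrightarrow> X n i + t n * X n i ^ D" by simp
    show "(\<lambda>k. \<Phi> (Y n k) i) \<longlonglongrightarrow> \<Phi> (X n) i" by (intro cont X)
  qed
  define Z where "Z k = (\<Phi> ^^ k) (\<lambda>_. 0)" for k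
  have Y_tendsto: "(\<lambda>n. Y n k i) \<longlonglongrightarrow> Z k i" for k i
  proof (induction k arbitrary: i)
    case (Suc k)
    have lim: "(\<lambda>n. \<Phi> (Y n k) i) \<longlonglongrightarrow> Z (Suc k) i"
      using cont[OF Suc] by (simp add: Z_def)
    \<comment> \<open>All iterates lie in [0, 1], so the perturbation changes a step by at most
      \<open>t n\<close>.\<close>
    have lower: "\<Phi> (Y n k) i - t n \<le> Y n (Suc k) i" for n
    proof -
      have "Y n (Suc k) i ^ D \<le> 1"
        by (rule power_le_one[OF Y_nonneg order_trans[OF Y_le F(2)]])
      then have "t n * Y n (Suc k) i ^ D \<le> t n"
        using t(1)[of n] by simp
      moreover have "Y n (Suc k) i + t n * Y n (Suc k) i ^ D = \<Phi> (Y n k) i"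
        unfolding Y_Suc by (intro g nonneg Y_nonneg t)
      ultimately show ?thesis by simp
    qed
    have upper: "Y n (Suc k) i \<le> \<Phi> (Y n k) i" for n
      unfolding Y_Suc by (intro g_le nonneg Y_nonneg t)
    show ?case
      by (rule tendsto_sandwich[OF _ _ _ lim, where f = "\<lambda>n. \<Phi> (Y n k) i - t n"])
        (use lower upper tendsto_diff[OF lim t(2)] in auto)
  qed (simp add: Y0 Z_def)
  \<comment> \<open>\<open>T\<close> is only a sub-iteration of \<open>\<Phi>\<close>, but starting
    at 0 it stays below the true iteration \<open>Z\<close> by monotonicity.\<close>
  have T_le_Z: "T k i \<le> Z k i" for k i
  proof (induction k arbitrary: i)
    case (Suc k)
    have "T (Suc k) i \<le> \<Phi> (T k) i" by (rule T)
    also have "\<dots> \<le> \<Phi> (Z k) i" by (intro mono T Suc)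
    finally show ?case by (simp add: Z_def)
  qed (simp add: T Z_def)
  have "(\<lambda>n. X n i) \<longlonglongrightarrow> F i" for i
  proof (rule order_tendstoI)
    fix a assume "a < F i"
    then have "\<forall>\<^sub>F k in sequentially. a < T k i"
      by (rule order_tendstoD(1)[OF T(4)])
    then obtain k where "a < T k i"
      by (auto simp: eventually_sequentially)
    then have "a < Z k i" using T_le_Z by (rule less_le_trans)
    then have "\<forall>\<^sub>F n in sequentially. a < Y n k i"
      using order_tendstoD(1)[OF Y_tendsto] by blast
    then show "\<forall>\<^sub>F n in sequentially. a < X n i"
      by (rule eventually_mono) (rule less_le_trans[OF _ Y_le_X])
  next
    fix a assume "F i < a"
    then show "\<forall>\<^sub>F n in sequentially. X n i < a"
      using X_le le_less_trans by (intro always_eventually) blast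
  qed
  with fixpoint show thesis by (rule that)
qed

section \<open>Stack-emptying probabilities\<close>

text \<open>The probability that the stack \<open>u\<close> is emptied within \<open>k\<close> steps, ending in state \<open>s'\<close>.\<close>
fun hit :: "('s \<Rightarrow> bool \<Rightarrow> 'g \<Rightarrow> 's) \<Rightarrow> ('s \<Rightarrow> bool \<Rightarrow> 'g \<Rightarrow> 'g list) \<Rightarrow> real \<Rightarrow> nat \<Rightarrow>
    's \<Rightarrow> 'g list \<Rightarrow> 's \<Rightarrow> real" where
  "hit \<sigma> \<rho> p k s [] s' = (if s = s' then 1 else 0)"
| "hit \<sigma> \<rho> p 0 s (b # u) s' = 0"
| "hit \<sigma> \<rho> p (Suc k) s (b # u) s' =
     p * hit \<sigma> \<rho> p k (\<sigma> s True b) (\<rho> s True b @ u) s'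
     + (1 - p) * hit \<sigma> \<rho> p k (\<sigma> s False b) (\<rho> s False b @ u) s'"

lemma pda_lang_Nil: "pda_lang s [] \<sigma> \<rho> S = (if s \<in> S then {[]} else {})"
proof -
  have "pda_run \<sigma> \<rho> (s, []) w = (s, [])" for w
    unfolding pda_run_def by (induction w) auto
  then show ?thesis by (auto simp: pda_lang_def)
qed

lemma Nil_in_pda_lang: "[] \<notin> pda_lang s (b # u) \<sigma> \<rho> S"
  by (simp add: pda_lang_def pda_run_def)

lemma Cons_in_pda_lang:
  "x # w \<in> pda_lang s (b # u) \<sigma> \<rho> S \<longleftrightarrow> w \<in> pda_lang (\<sigma> s x b) (\<rho> s x b @ u) \<sigma> \<rho> S"
  by (auto simp: pda_lang_def pda_run_def All_less_Suc2)

lemma Pw_Nil: "Pw p [] = 1"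
  and Pw_Cons: "Pw p (x # w) = (if x then p else 1 - p) * Pw p w"
  by (simp_all add: Pw_def n1_def n0_def)

lemma finite_short_words: "finite {w :: bool list. w \<in> L \<and> length w \<le> k}"
  by (rule finite_subset[OF _ finite_lists_length_le[of UNIV k]]) auto

text \<open>Conditioning on the first input bit matches the recursion of \<open>hit\<close>; reading
  a bit costs one unit of the length bound.\<close>

lemma sum_Pw_pda_lang:
  fixes s :: "'s::finite"
  shows "(\<Sum>w | w \<in> pda_lang s u \<sigma> \<rho> S \<and> length w \<le> k. Pw p w) = (\<Sum>s'\<in>S. hit \<sigma> \<rho> p k s u s')"
proof (induction k arbitrary: s u)
  case 0
  show ?case
  proof (cases u)
    case Nil
    then show ?thesis by (simp add: pda_lang_Nil Pw_Nil)
  next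
    case (Cons b v)
    then show ?thesis by (simp add: Nil_in_pda_lang cong: conj_cong)
  qed
next
  case (Suc k)
  show ?case
  proof (cases u)
    case Nil
    then have "{w. w \<in> pda_lang s u \<sigma> \<rho> S \<and> length w \<le> Suc k} = (if s \<in> S then {[]} else {})"
      by (auto simp: pda_lang_Nil)
    then show ?thesis by (simp add: Nil Pw_Nil)
  next
    case (Cons b v)
    define A where "A x = {w. w \<in> pda_lang (\<sigma> s x b) (\<rho> s x b @ v) \<sigma> \<rho> S \<and> length w \<le> k}" for x
    have fin: "finite (A x)" for x unfolding A_def by (rule finite_short_words)
    have "{w. w \<in> pda_lang s u \<sigma> \<rho> S \<and> length w \<le> Suc k} = (#) True ` A True \<union> (#) False ` A False"
      (is "?L = ?R")
    proof (rule set_eqI)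
      fix w show "w \<in> ?L \<longleftrightarrow> w \<in> ?R"
      proof (cases w)
        case Nil
        then show ?thesis by (auto simp: Cons Nil_in_pda_lang)
      next
        case w: (Cons x w')
        then show ?thesis by (cases x) (auto simp: Cons Cons_in_pda_lang A_def)
      qed
    qed
    then have "(\<Sum>w | w \<in> pda_lang s u \<sigma> \<rho> S \<and> length w \<le> Suc k. Pw p w)
        = (\<Sum>w\<in>(#) True ` A True \<union> (#) False ` A False. Pw p w)"
      by (rule arg_cong)
    also have "\<dots>
        = (\<Sum>w\<in>(#) True ` A True. Pw p w) + (\<Sum>w\<in>(#) False ` A False. Pw p w)"
      by (rule sum.union_disjoint) (use fin in auto)
    also have "\<dots> = p * (\<Sum>w\<in>A True. Pw p w) + (1 - p) * (\<Sum>w\<in>A False. Pw p w)"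
      by (simp add: sum.reindex Pw_Cons sum_distrib_left)
    also have "\<dots> = (\<Sum>s'\<in>S. hit \<sigma> \<rho> p (Suc k) s u s')"
      unfolding A_def Suc by (simp add: Cons sum.distrib sum_distrib_left)
    finally show ?thesis .
  qed
qed

text \<open>Words of bounded length form a finite set, and every finite subset of \<open>L\<close>
  has a length bound, so truncations by length are cofinal among the finite subsets that define the
  sum.\<close>

lemma has_sum_imp_tendsto_short_words:
  fixes g :: "bool list \<Rightarrow> real"
  assumes "(g has_sum c) L"
  shows "(\<lambda>k. \<Sum>w | w \<in> L \<and> length w \<le> k. g w) \<longlonglongrightarrow> c"
proof -
  have "filterlim (\<lambda>k. {w. w \<in> L \<and> length w \<le> k}) (finite_subsets_at_top L) sequentially"
    unfolding filterlim_finite_subsets_at_top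
  proof (intro allI impI)
    fix A assume A: "finite A \<and> A \<subseteq> L"
    show "\<forall>\<^sub>F k in sequentially. finite {w. w \<in> L \<and> length w \<le> k}
        \<and> A \<subseteq> {w. w \<in> L \<and> length w \<le> k} \<and> {w. w \<in> L \<and> length w \<le> k} \<subseteq> L"
      using eventually_ge_at_top[of "Max (length ` A)"]
    proof eventually_elim
      case (elim k)
      have "length w \<le> k" if "w \<in> A" for w
      proof -
        have "length w \<le> Max (length ` A)" using that A by (intro Max_ge) auto
        then show ?thesis using elim by simp
      qed
      then show ?case using A finite_short_words[of L k] by auto
    qed
  qed
  with assms show ?thesis unfolding has_sum_def by (rule filterlim_compose)
qed

section \<open>Time-bounded emptying probabilities and their limits\<close>

context
  fixes \<sigma> :: "'s::finite \<Rightarrow> bool \<Rightarrow> 'g \<Rightarrow> 's" and \<rho> :: "'s \<Rightarrow> bool \<Rightarrow> 'g \<Rightarrow> 'g list" and p :: real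
  assumes p: "0 \<le> p" "p \<le> 1"
begin

lemma hit_nonneg: "0 \<le> hit \<sigma> \<rho> p k s u s'"
  using p by (induction \<sigma> \<rho> p k s u s' rule: hit.induct) auto

lemma hit_mono_Suc: "hit \<sigma> \<rho> p k s u s' \<le> hit \<sigma> \<rho> p (Suc k) s u s'"
proof (induction k arbitrary: s u)
  case 0
  show ?case using p by (cases u) (auto intro!: add_nonneg_nonneg mult_nonneg_nonneg hit_nonneg)
next
  case (Suc k)
  show ?case
  proof (cases u)
    case (Cons b v)
    then show ?thesis using p Suc
      by (simp only: hit.simps) (intro add_mono mult_left_mono, auto)
  qed simp
qed

lemma hit_mono: "k \<le> l \<Longrightarrow> hit \<sigma> \<rho> p k s u s' \<le> hit \<sigma> \<rho> p l s u s'"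
  by (rule lift_Suc_mono_le[of "\<lambda>k. hit \<sigma> \<rho> p k s u s'"]) (rule hit_mono_Suc)

text \<open>Each step averages sums that are at most 1. The bound makes the increasing sequences in
  \<open>k\<close> converge and keeps their limits within [0, 1].\<close>

lemma sum_hit_le_1: "(\<Sum>s'\<in>UNIV. hit \<sigma> \<rho> p k s u s') \<le> 1"
proof (induction k arbitrary: s u)
  case 0
  show ?case by (cases u) auto
next
  case (Suc k)
  show ?case
  proof (cases u)
    case (Cons b v)
    have "(\<Sum>s'\<in>UNIV. hit \<sigma> \<rho> p (Suc k) s u s')
        = p * (\<Sum>s'\<in>UNIV. hit \<sigma> \<rho> p k (\<sigma> s True b) (\<rho> s True b @ v) s')
        + (1 - p) * (\<Sum>s'\<in>UNIV. hit \<sigma> \<rho> p k (\<sigma> s False b) (\<rho> s False b @ v) s')"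
      by (simp add: Cons sum.distrib sum_distrib_left)
    also have "\<dots> \<le> p * 1 + (1 - p) * 1"
      using p by (intro add_mono mult_left_mono Suc) auto
    finally show ?thesis by simp
  qed simp
qed

lemma hit_le_1: "hit \<sigma> \<rho> p k s u s' \<le> 1"
  using member_le_sum[of s' UNIV "\<lambda>s'. hit \<sigma> \<rho> p k s u s'"] hit_nonneg sum_hit_le_1
  by (meson UNIV_I finite order_trans)

text \<open>The lower part \<open>v\<close> is untouched until \<open>u\<close> is gone, so the run
  splits at the state \<open>r\<close> reached then. Granting each part all \<open>k\<close> steps
  gives an upper bound.\<close>

lemma hit_append_le:
  "hit \<sigma> \<rho> p k s (u @ v) s' \<le> (\<Sum>r\<in>UNIV. hit \<sigma> \<rho> p k s u r * hit \<sigma> \<rho> p k r v s')"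
proof (induction k arbitrary: s u)
  case 0
  show ?case
    by (cases u) (auto simp: if_distrib[of "\<lambda>x. x * _"] cong: if_cong)
next
  case (Suc k)
  show ?case
  proof (cases u)
    case Nil
    then show ?thesis by (simp add: if_distrib[of "\<lambda>x. x * _"] cong: if_cong)
  next
    case (Cons b w)
    have IH: "hit \<sigma> \<rho> p k (\<sigma> s x b) (\<rho> s x b @ w @ v) s'
        \<le> (\<Sum>r\<in>UNIV. hit \<sigma> \<rho> p k (\<sigma> s x b) (\<rho> s x b @ w) r * hit \<sigma> \<rho> p (Suc k) r v s')" for x
    proof -
      have "hit \<sigma> \<rho> p k (\<sigma> s x b) ((\<rho> s x b @ w) @ v) s'
          \<le> (\<Sum>r\<in>UNIV. hit \<sigma> \<rho> p k (\<sigma> s x b) (\<rho> s x b @ w) r * hit \<sigma> \<rho> p k r v s')"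
        by (rule Suc)
      also have "\<dots> \<le> (\<Sum>r\<in>UNIV. hit \<sigma> \<rho> p k (\<sigma> s x b) (\<rho> s x b @ w) r * hit \<sigma> \<rho> p (Suc k) r v s')"
        by (intro sum_mono mult_left_mono hit_mono_Suc hit_nonneg)
      finally show ?thesis by simp
    qed
    have "hit \<sigma> \<rho> p (Suc k) s (u @ v) s'
        \<le> p * (\<Sum>r\<in>UNIV. hit \<sigma> \<rho> p k (\<sigma> s True b) (\<rho> s True b @ w) r * hit \<sigma> \<rho> p (Suc k) r v s')
        + (1 - p) * (\<Sum>r\<in>UNIV. hit \<sigma> \<rho> p k (\<sigma> s False b) (\<rho> s False b @ w) r * hit \<sigma> \<rho> p (Suc k) r v s')"
      unfolding Cons append_Cons hit.simps(3)
      using p by (intro add_mono mult_left_mono IH) auto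
    also have "\<dots> = (\<Sum>r\<in>UNIV. hit \<sigma> \<rho> p (Suc k) s u r * hit \<sigma> \<rho> p (Suc k) r v s')"
      unfolding Cons hit.simps(3) by (simp only: sum_distrib_left sum.distrib distrib_right mult.assoc)
    finally show ?thesis .
  qed
qed

text \<open>Time bounds add up: \<open>k\<close> steps for \<open>u\<close> and \<open>l\<close> for
  \<open>v\<close> fit into \<open>k + l\<close>. This is the counterpart of
  \<open>hit_append_le\<close> that pins down the limit.\<close>

lemma hit_append_ge:
  "(\<Sum>r\<in>UNIV. hit \<sigma> \<rho> p k s u r * hit \<sigma> \<rho> p l r v s') \<le> hit \<sigma> \<rho> p (k + l) s (u @ v) s'"
proof (induction k arbitrary: s u)
  case 0
  show ?case
    by (cases u) (auto simp: if_distrib[of "\<lambda>x. x * _"] hit_nonneg cong: if_cong)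
next
  case (Suc k)
  show ?case
  proof (cases u)
    case Nil
    then show ?thesis
      using hit_mono[of l "Suc k + l" s v s'] by (simp add: if_distrib[of "\<lambda>x. x * _"] cong: if_cong)
  next
    case (Cons b w)
    have "(\<Sum>r\<in>UNIV. hit \<sigma> \<rho> p (Suc k) s u r * hit \<sigma> \<rho> p l r v s')
        = p * (\<Sum>r\<in>UNIV. hit \<sigma> \<rho> p k (\<sigma> s True b) (\<rho> s True b @ w) r * hit \<sigma> \<rho> p l r v s')
        + (1 - p) * (\<Sum>r\<in>UNIV. hit \<sigma> \<rho> p k (\<sigma> s False b) (\<rho> s False b @ w) r * hit \<sigma> \<rho> p l r v s')"
      unfolding Cons hit.simps(3) by (simp only: sum_distrib_left sum.distrib distrib_right mult.assoc)
    also have "\<dots> \<le> p * hit \<sigma> \<rho> p (k + l) (\<sigma> s True b) ((\<rho> s True b @ w) @ v) s'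
        + (1 - p) * hit \<sigma> \<rho> p (k + l) (\<sigma> s False b) ((\<rho> s False b @ w) @ v) s'"
      using p by (intro add_mono mult_left_mono Suc) auto
    also have "\<dots> = hit \<sigma> \<rho> p (Suc k + l) s (u @ v) s'"
      by (simp add: Cons)
    finally show ?thesis .
  qed
qed

definition hit_lim :: "'s \<Rightarrow> 'g list \<Rightarrow> 's \<Rightarrow> real" where
  "hit_lim s u s' = lim (\<lambda>k. hit \<sigma> \<rho> p k s u s')"

lemma hit_tendsto: "(\<lambda>k. hit \<sigma> \<rho> p k s u s') \<longlonglongrightarrow> hit_lim s u s'"
proof -
  have "incseq (\<lambda>k. hit \<sigma> \<rho> p k s u s')" by (intro incseq_SucI hit_mono_Suc)
  then have "convergent (\<lambda>k. hit \<sigma> \<rho> p k s u s')"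
    using incseq_convergent[of "\<lambda>k. hit \<sigma> \<rho> p k s u s'" 1] hit_le_1 unfolding convergent_def by metis
  then show ?thesis by (simp add: hit_lim_def convergent_LIMSEQ_iff)
qed

lemma hit_lim_nonneg: "0 \<le> hit_lim s u s'"
  using LIMSEQ_le_const[OF hit_tendsto] hit_nonneg by blast

lemma hit_lim_le_1: "hit_lim s u s' \<le> 1"
  using LIMSEQ_le_const2[OF hit_tendsto] hit_le_1 by blast

lemma hit_lim_Nil: "hit_lim s [] s' = (if s = s' then 1 else 0)"
  by (simp add: hit_lim_def)

lemma hit_lim_append: "hit_lim s (u @ v) s' = (\<Sum>r\<in>UNIV. hit_lim s u r * hit_lim r v s')"
proof (rule antisym)
  have lim: "(\<lambda>k. \<Sum>r\<in>UNIV. hit \<sigma> \<rho> p k s u r * hit \<sigma> \<rho> p k r v s')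
      \<longlonglongrightarrow> (\<Sum>r\<in>UNIV. hit_lim s u r * hit_lim r v s')"
    by (intro tendsto_intros hit_tendsto)
  show "hit_lim s (u @ v) s' \<le> (\<Sum>r\<in>UNIV. hit_lim s u r * hit_lim r v s')"
    using LIMSEQ_le[OF hit_tendsto lim] hit_append_le by blast
  \<comment> \<open>Taking \<open>l = k\<close> in the lower bound leads to time
    \<open>2 * k\<close>, a subsequence with the same limit.\<close>
  have "(\<lambda>k. hit \<sigma> \<rho> p (2 * k) s (u @ v) s') \<longlonglongrightarrow> hit_lim s (u @ v) s'"
    using LIMSEQ_subseq_LIMSEQ[OF hit_tendsto, of "\<lambda>k. 2 * k"] by (simp add: strict_mono_def o_def)
  then show "(\<Sum>r\<in>UNIV. hit_lim s u r * hit_lim r v s') \<le> hit_lim s (u @ v) s'"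
    using hit_append_ge[of _ s u _ v s']
    by (intro LIMSEQ_le[OF lim]) (auto simp: mult_2 intro!: exI[of _ 0])
qed

lemma hit_lim_step:
  "hit_lim s [b] s' = p * hit_lim (\<sigma> s True b) (\<rho> s True b) s'
     + (1 - p) * hit_lim (\<sigma> s False b) (\<rho> s False b) s'"
proof (rule LIMSEQ_unique)
  show "(\<lambda>k. hit \<sigma> \<rho> p (Suc k) s [b] s') \<longlonglongrightarrow> hit_lim s [b] s'"
    by (rule LIMSEQ_Suc[OF hit_tendsto])
  show "(\<lambda>k. hit \<sigma> \<rho> p (Suc k) s [b] s') \<longlonglongrightarrow> p * hit_lim (\<sigma> s True b) (\<rho> s True b) s'
     + (1 - p) * hit_lim (\<sigma> s False b) (\<rho> s False b) s'"
    by (auto intro!: tendsto_intros hit_tendsto)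
qed

end

section \<open>The polynomial system for the single-symbol probabilities\<close>

text \<open>The probability of emptying the stack \<open>u\<close> if \<open>X (s, b, s')\<close> is that of removing the single
  symbol \<open>b\<close>: the stack is removed symbol by symbol, and \<open>r\<close> is the state when \<open>b\<close> is gone.\<close>
fun word_val :: "('s::finite \<times> 'g \<times> 's \<Rightarrow> real) \<Rightarrow> 's \<Rightarrow> 'g list \<Rightarrow> 's \<Rightarrow> real" where
  "word_val X s [] s' = (if s = s' then 1 else 0)"
| "word_val X s (b # u) s' = (\<Sum>r\<in>UNIV. X (s, b, r) * word_val X r u s')"

lemma word_val_nonneg: "(\<And>j. 0 \<le> X j) \<Longrightarrow> 0 \<le> word_val X s u s'"
  by (induction u arbitrary: s) (auto intro!: sum_nonneg mult_nonneg_nonneg)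

lemma word_val_mono:
  assumes "\<And>j. 0 \<le> X j" "\<And>j. X j \<le> Y j"
  shows "word_val X s u s' \<le> word_val Y s u s'"
proof (induction u arbitrary: s)
  case (Cons b u)
  have "0 \<le> Y j" for j using assms order_trans by blast
  then show ?case unfolding word_val.simps
    by (intro sum_mono mult_mono assms Cons word_val_nonneg)
qed simp

lemma tendsto_word_val:
  assumes "\<And>j. ((\<lambda>n. X n j) \<longlongrightarrow> L j) net"
  shows "((\<lambda>n. word_val (X n) s u s') \<longlongrightarrow> word_val L s u s') net"
  by (induction u arbitrary: s) (auto intro!: tendsto_intros assms)

text \<open>Each stack symbol contributes one unknown to every product, so the word length bounds
  the degree.\<close>

lemma polyfun_word_val: "polyfun (length u) (\<lambda>t p X. word_val X s u s')"
proof (induction u arbitrary: s)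
  case Nil
  then show ?case by (simp add: polyfun_const)
next
  case (Cons b u)
  have "polyfun (Suc 0 + length u) (\<lambda>t p X. \<Sum>r\<in>UNIV. X (s, b, r) * word_val X r u s')"
    by (intro polyfun_sum polyfun_mult polyfun_var Cons)
  then show ?case by simp
qed

definition step_val :: "('s::finite \<Rightarrow> bool \<Rightarrow> 'g \<Rightarrow> 's) \<Rightarrow> ('s \<Rightarrow> bool \<Rightarrow> 'g \<Rightarrow> 'g list) \<Rightarrow> real \<Rightarrow>
    ('s \<times> 'g \<times> 's \<Rightarrow> real) \<Rightarrow> 's \<times> 'g \<times> 's \<Rightarrow> real" where
  "step_val \<sigma> \<rho> p X = (\<lambda>(s, b, s').
     p * word_val X (\<sigma> s True b) (\<rho> s True b) s'
     + (1 - p) * word_val X (\<sigma> s False b) (\<rho> s False b) s')"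

lemma polyfun_step_val:
  assumes "\<And>s x b. length (\<rho> s x b) \<le> d"
  shows "polyfun d (\<lambda>t p X. step_val \<sigma> \<rho> p X i)"
proof (cases i)
  case (fields s b s')
  have w: "polyfun d (\<lambda>t p X. word_val X (\<sigma> s x b) (\<rho> s x b) s')" for x
    using polyfun_word_val assms by (rule polyfun_mono)
  have "polyfun (0 + d) (\<lambda>t p X. p * word_val X (\<sigma> s True b) (\<rho> s True b) s'
     + (1 - p) * word_val X (\<sigma> s False b) (\<rho> s False b) s')"
    by (intro polyfun.add polyfun_mult polyfun_param w)
  then show ?thesis by (simp add: step_val_def fields)
qed

text \<open>Iterates \<open>hit_append_le\<close> along the word. Since every symbol is granted all
  \<open>k\<close> steps, the time-bounded probabilities satisfy the system only as an inequality,
  the form required of \<open>T\<close> in \<open>perturbed_fixpoints_converge\<close>.\<close>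

lemma hit_le_word_val:
  fixes \<sigma> :: "'s::finite \<Rightarrow> bool \<Rightarrow> 'g \<Rightarrow> 's"
  assumes p: "0 \<le> p" "p \<le> 1"
  shows "hit \<sigma> \<rho> p k s u s' \<le> word_val (\<lambda>(s, b, s'). hit \<sigma> \<rho> p k s [b] s') s u s'"
proof (induction u arbitrary: s)
  case (Cons b u)
  have "hit \<sigma> \<rho> p k s ([b] @ u) s' \<le> (\<Sum>r\<in>UNIV. hit \<sigma> \<rho> p k s [b] r * hit \<sigma> \<rho> p k r u s')"
    using p by (rule hit_append_le)
  also have "\<dots> \<le> (\<Sum>r\<in>UNIV. hit \<sigma> \<rho> p k s [b] r
      * word_val (\<lambda>(s, b, s'). hit \<sigma> \<rho> p k s [b] s') r u s')"
    by (intro sum_mono mult_left_mono Cons hit_nonneg p)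
  finally show ?case by simp
qed simp

text \<open>In the limit the splitting is exact, by \<open>hit_lim_append\<close>. Together with
  \<open>hit_lim_step\<close> this makes the single-symbol limits a fixed point of
  \<open>step_val\<close>.\<close>

lemma hit_lim_eq_word_val:
  fixes \<sigma> :: "'s::finite \<Rightarrow> bool \<Rightarrow> 'g \<Rightarrow> 's"
  assumes p: "0 \<le> p" "p \<le> 1"
  shows "hit_lim \<sigma> \<rho> p s u s' = word_val (\<lambda>(s, b, s'). hit_lim \<sigma> \<rho> p s [b] s') s u s'"
proof (induction u arbitrary: s)
  case Nil
  show ?case using p by (simp add: hit_lim_Nil)
next
  case (Cons b u)
  have "hit_lim \<sigma> \<rho> p s ([b] @ u) s' = (\<Sum>r\<in>UNIV. hit_lim \<sigma> \<rho> p s [b] r * hit_lim \<sigma> \<rho> p r u s')"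
    using p by (rule hit_lim_append)
  then show ?case by (simp add: Cons)
qed

lemma has_sum_pda_lang_eq_hit_lim:
  fixes \<sigma> :: "'s::finite \<Rightarrow> bool \<Rightarrow> 'g \<Rightarrow> 's"
  assumes p: "0 \<le> p" "p \<le> 1" and sum: "(Pw p has_sum c) (pda_lang s u \<sigma> \<rho> S)"
  shows "c = (\<Sum>s'\<in>S. hit_lim \<sigma> \<rho> p s u s')"
proof (rule LIMSEQ_unique)
  show "(\<lambda>k. \<Sum>s'\<in>S. hit \<sigma> \<rho> p k s u s') \<longlonglongrightarrow> c"
    using has_sum_imp_tendsto_short_words[OF sum] by (simp only: sum_Pw_pda_lang)
  show "(\<lambda>k. \<Sum>s'\<in>S. hit \<sigma> \<rho> p k s u s') \<longlonglongrightarrow> (\<Sum>s'\<in>S. hit_lim \<sigma> \<rho> p s u s')"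
    by (intro tendsto_sum hit_tendsto p)
qed

lemma perturbed_step_val_converges:
  fixes \<sigma> :: "'s::finite \<Rightarrow> bool \<Rightarrow> 'g \<Rightarrow> 's" and t :: "nat \<Rightarrow> real"
  assumes p: "0 \<le> p" "p \<le> 1" and D: "0 < D" and t: "\<And>n. 0 < t n" "t \<longlonglongrightarrow> 0"
  obtains X where "\<And>n i. X n i + t n * X n i ^ D = step_val \<sigma> \<rho> p (X n) i"
    "\<And>s b s'. (\<lambda>n. X n (s, b, s')) \<longlonglongrightarrow> hit_lim \<sigma> \<rho> p s [b] s'"
proof -
  define F where "F = (\<lambda>(s, b, s'). hit_lim \<sigma> \<rho> p s [b] s')"
  define T where "T k = (\<lambda>(s, b, s'). hit \<sigma> \<rho> p k s [b] s')" for k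
  obtain X where X: "\<And>n i. X n i + t n * X n i ^ D = step_val \<sigma> \<rho> p (X n) i"
    "\<And>i. (\<lambda>n. X n i) \<longlonglongrightarrow> F i"
  proof (rule perturbed_fixpoints_converge[of "step_val \<sigma> \<rho> p" F T D t])
    fix X Y :: "'s \<times> 'g \<times> 's \<Rightarrow> real" and Z :: "nat \<Rightarrow> 's \<times> 'g \<times> 's \<Rightarrow> real" and i
    show "0 \<le> step_val \<sigma> \<rho> p X i" if "\<And>j. 0 \<le> X j"
      using p that by (auto simp: step_val_def word_val_nonneg split: prod.split)
    show "step_val \<sigma> \<rho> p X i \<le> step_val \<sigma> \<rho> p Y i" if "\<And>j. 0 \<le> X j" "\<And>j. X j \<le> Y j"
      using p word_val_mono[OF that]
      by (auto simp: step_val_def split: prod.split intro!: add_mono mult_left_mono)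
    show "(\<lambda>n. step_val \<sigma> \<rho> p (Z n) i) \<longlonglongrightarrow> step_val \<sigma> \<rho> p X i"
      if "\<And>j. (\<lambda>n. Z n j) \<longlonglongrightarrow> X j"
      by (cases i) (auto simp: step_val_def intro!: tendsto_intros tendsto_word_val that)
    show "0 \<le> F i" "F i \<le> 1"
      using hit_lim_nonneg[OF p] hit_lim_le_1[OF p] by (auto simp: F_def split: prod.split)
    show "step_val \<sigma> \<rho> p F i \<le> F i"
    proof (cases i)
      case (fields s b s')
      show ?thesis
        unfolding fields step_val_def F_def prod.case hit_lim_eq_word_val[OF p, symmetric]
        using hit_lim_step[OF p] by (rule eq_refl[OF sym])
    qed
    show "T 0 i = 0" by (cases i) (simp add: T_def)
    fix k
    show "0 \<le> T k i" using hit_nonneg[OF p] by (auto simp: T_def split: prod.split)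
    show "T (Suc k) i \<le> step_val \<sigma> \<rho> p (T k) i"
      using p hit_le_word_val[OF p]
      by (cases i) (auto simp: T_def step_val_def intro!: add_mono mult_left_mono)
    show "(\<lambda>k. T k i) \<longlonglongrightarrow> F i"
      using hit_tendsto[OF p] by (cases i) (simp add: T_def F_def)
  qed (use D t in auto)
  show thesis
    using X(1) X(2)[of "(_, _, _)"] unfolding F_def prod.case by (rule that)
qed

section \<open>Algebraicity of the simulated function\<close>

theorem theorem2:
  fixes f :: "real \<Rightarrow> real"
    and s0 :: "'s::finite" and tau :: "'g::finite list"
    and \<sigma> :: "'s \<Rightarrow> bool \<Rightarrow> 'g \<Rightarrow> 's" and \<rho> :: "'s \<Rightarrow> bool \<Rightarrow> 'g \<Rightarrow> 'g list"
    and S0 S1 :: "'s set"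
  assumes "\<forall>p\<in>{0<..<1}. f p \<in> {0<..<1}"
    and "pda_simulates s0 tau \<sigma> \<rho> S0 S1 {0<..<1} f"
  shows "\<exists>P :: rat poly poly. P \<noteq> 0 \<and> (\<forall>p\<in>{0<..<1}. eval2 P (f p) p = 0)"
proof -
  \<comment> \<open>\<open>m\<close> bounds the length of the words pushed in one step, so the
    system has degree at most \<open>Suc m\<close>, which is positive even if nothing is ever
    pushed; \<open>D\<close> is one larger.\<close>
  define m where "m = Max (range (\<lambda>(s, x, b). length (\<rho> s x b)))"
  define D where "D = Suc (Suc m)"
  have "length (\<rho> s x b) \<le> Suc m" for s x b
    unfolding m_def by (intro le_SucI Max_ge) (auto intro: rev_image_eqI[of "(s, x, b)"])
  then have \<Phi>: "polyfun (Suc m) (\<lambda>t p X. step_val \<sigma> \<rho> p X i)" for i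
    by (rule polyfun_step_val)
  \<comment> \<open>\<open>V\<close> collects the solutions for all t and p at once, so that
    \<open>c\<close> below, and with it \<open>P\<close>, does not depend on p.\<close>
  define V where "V = {(t, p, X). \<forall>i. X i + t * X i ^ D = step_val \<sigma> \<rho> p X i}"
  define g where "g X = (\<Sum>s'\<in>S1. word_val X s0 tau s')" for X :: "'s \<times> 'g \<times> 's \<Rightarrow> real"
  have g: "polyfun (length tau) (\<lambda>t p X. g X)"
    unfolding g_def by (intro polyfun_sum polyfun_word_val)
  have m: "0 < Suc m" "Suc m < D" by (simp_all add: D_def)
  have V: "X i + t * X i ^ D = step_val \<sigma> \<rho> p X i" if "(t, p, X) \<in> V" for t p X i
    using that unfolding V_def by blast
  obtain N c where c: "\<exists>k\<in>{..N}. coeff (c k) 0 \<noteq> 0"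
    and rel: "\<And>t p X. (t, p, X) \<in> V \<Longrightarrow> t \<noteq> 0 \<Longrightarrow> (\<Sum>k\<le>N. eval2 (c k) t p * g X ^ k) = 0"
    using perturbed_algebraic_relation[OF \<Phi> m V g] by blast
  \<comment> \<open>The relation at t = 0: its coefficients become polynomials in p, and the outer
    variable now stands for \<open>f p\<close>.\<close>
  define P where "P = (\<Sum>k\<le>N. monom (coeff (c k) 0) k)"
  obtain k where "k \<le> N" "coeff (c k) 0 \<noteq> 0" using c by blast
  then have "coeff P k \<noteq> 0" by (simp add: P_def coeff_sum)
  then have "P \<noteq> 0" by auto
  moreover have "eval2 P (f p) p = 0" if p01: "p \<in> {0<..<1}" for p
  proof -
    have p: "0 \<le> p" "p \<le> 1" using p01 by auto
    define F where "F = (\<lambda>(s, b, s'). hit_lim \<sigma> \<rho> p s [b] s')"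
    have "(Pw p has_sum f p) (pda_lang s0 tau \<sigma> \<rho> S1)"
      using assms(2) p01 by (auto simp: pda_simulates_def is_simulation_def)
    from has_sum_pda_lang_eq_hit_lim[OF p this] have f: "f p = g F"
      unfolding g_def F_def by (simp only: hit_lim_eq_word_val[OF p, of \<sigma> \<rho> s0 tau])
    define t where "t n = inverse (real (Suc n))" for n
    have t: "0 < t n" "t \<longlonglongrightarrow> 0" for n
      unfolding t_def using LIMSEQ_inverse_real_of_nat by auto
    obtain X where X: "\<And>n i. X n i + t n * X n i ^ D = step_val \<sigma> \<rho> p (X n) i"
      "\<And>s b s'. (\<lambda>n. X n (s, b, s')) \<longlonglongrightarrow> hit_lim \<sigma> \<rho> p s [b] s'"
      using perturbed_step_val_converges[OF p _ t, of D \<sigma> \<rho>] m by auto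
    have "(\<lambda>n. X n i) \<longlonglongrightarrow> F i" for i
      using X(2) by (cases i) (simp add: F_def)
    then have "(\<lambda>n. g (X n)) \<longlonglongrightarrow> g F"
      unfolding g_def by (intro tendsto_sum tendsto_word_val)
    \<comment> \<open>The relation is available along \<open>t n > 0\<close>; continuity carries it
      to t = 0, where \<open>X n\<close> has become \<open>F\<close>.\<close>
    then have "(\<lambda>n. \<Sum>k\<le>N. eval2 (c k) (t n) p * g (X n) ^ k)
        \<longlonglongrightarrow> (\<Sum>k\<le>N. eval2 (c k) 0 p * g F ^ k)"
      by (intro tendsto_intros tendsto_eval2 t)
    moreover have "(\<Sum>k\<le>N. eval2 (c k) (t n) p * g (X n) ^ k) = 0" for n
      using rel[of "t n" p "X n"] X(1) t(1)[of n] by (simp add: V_def)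
    ultimately have "(\<Sum>k\<le>N. eval2 (c k) 0 p * f p ^ k) = 0"
      by (simp add: f LIMSEQ_const_iff)
    then show ?thesis by (simp add: P_def eval2_sum eval2_monom eval2_at_0)
  qed
  ultimately show ?thesis by blast
qed

end
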